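(* Let $X,Y$ be real separated (Hausdorff) locally convex spaces and let $\Phi:X\times Y\to\overline{\mathbb R}$ be a proper function such that $v(P_\Phi)\in\mathbb R$ and $\operatorname{pr}_{Y\times\mathbb R}(\operatorname{epi}\Phi)$ is a convex subset of $Y\times\mathbb R$ (the latter is the case if, for instance, $\Phi$ is convex). Suppose that at least one of the following two conditions is fulfilled: (RC6) $0\in\operatorname{qi}(\operatorname{pr}_Y(\operatorname{dom}\Phi))$ and $(0,0)\notin\operatorname{qri}[\operatorname{co}(E\cup\{(0,0)\})]$; (RC7) $0\in\operatorname{qi}[\operatorname{pr}_Y(\operatorname{dom}\Phi)-\operatorname{pr}_Y(\operatorname{dom}\Phi)]$, $0\in\operatorname{qri}(\operatorname{pr}_Y(\operatorname{dom}\Phi))$ and $(0,0)\notin\operatorname{qri}[\operatorname{co}(E\cup\{(0,0)\})]$. Then $v(P_\Phi)=v(D_\Phi)$ and $(D_\Phi)$ has an optimal solution.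
   Context: $\overline{\mathbb R}=\mathbb R\cup\{\pm\infty\}$. For $\Phi:X\times Y\to\overline{\mathbb R}$: $\operatorname{dom}\Phi=\{(x,y):\Phi(x,y)<+\infty\}$, $\operatorname{epi}\Phi=\{(x,y,r)\in X\times Y\times\mathbb R:\Phi(x,y)\le r\}$; $\Phi$ is proper if $\operatorname{dom}\Phi\ne\emptyset$ and $\Phi>-\infty$ everywhere. $\operatorname{pr}_Y$ and $\operatorname{pr}_{Y\times\mathbb R}$ denote the projections onto $Y$ and $Y\times\mathbb R$. Primal problem $(P_\Phi)$: $\inf_{x\in X}\Phi(x,0)$, with optimal value $v(P_\Phi)$. Dual problem $(D_\Phi)$: $\sup_{y^*\in Y^*}\{-\Phi^*(0,y^* )\}$, with optimal value $v(D_\Phi)$, where $Y^*$ is the topological dual of $Y$ and $\Phi^*(x^*,y^* )=\sup_{(x,y)\in X\times Y}\{\langle x^*,x\rangle+\langle y^*,y\rangle-\Phi(x,y)\}$. An optimal solution of $(D_\Phi)$ is a $y^*\in Y^*$ at which the supremum is attained. $E:=\operatorname{pr}_{Y\times\mathbb R}(\operatorname{epi}(\Phi-v(P_\Phi)))=\{(y,r)\in Y\times\mathbb R:\exists x\in X,\ \Phi(x,y)-v(P_\Phi)\le r\}$. For a nonempty convex subset $U$ of a separated locally convex space $V$, $\operatorname{cone}(U)=\bigcup_{t\ge0}tU$; the quasi interior is $\operatorname{qi}(U)=\{u\in U:\operatorname{cl}(\operatorname{cone}(U-u))=V\}$ and the quasi-relative interior is $\operatorname{qri}(U)=\{u\in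 U:\operatorname{cl}(\operatorname{cone}(U-u))\text{ is a linear subspace of }V\}$. $\operatorname{co}$ denotes the convex hull and $\operatorname{cl}$ the closure. (Convexity of $\operatorname{pr}_{Y\times\mathbb R}(\operatorname{epi}\Phi)$ implies convexity of $\operatorname{pr}_Y(\operatorname{dom}\Phi)$.) *)

theory Defs
  imports "HOL-Analysis.Analysis"
begin

text \<open>Real Hausdorff locally convex topological vector spaces. Continuity of addition and negation
  comes from \<^class>\<open>topological_ab_group_add\<close>; the first axiom is joint continuity of scalar
  multiplication. By translation it suffices to ask for convex neighbourhoods at the origin.
  Convexity is written out because \<^const>\<open>convex\<close> cannot be used inside the class specification.\<close>

class locally_convex_space = real_vector + topological_ab_group_add + t2_space +
  assumes tendsto_scaleR_nhds:
    "LIM p (nhds a \<times>\<^sub>F nhds x). fst p *\<^sub>R snd p :> nhds (a *\<^sub>R x)"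
  assumes convex_nhds_base_unfolded:
    "open U \<Longrightarrow> 0 \<in> U \<Longrightarrow> \<exists>V. open V \<and> 0 \<in> V \<and> V \<subseteq> U \<and>
       (\<forall>x\<in>V. \<forall>y\<in>V. \<forall>u\<ge>0. \<forall>v\<ge>0. u + v = 1 \<longrightarrow> u *\<^sub>R x + v *\<^sub>R y \<in> V)"

lemma convex_nhds_base:
  fixes U :: "'a::locally_convex_space set"
  assumes "open U" "0 \<in> U"
  shows "\<exists>V. open V \<and> convex V \<and> 0 \<in> V \<and> V \<subseteq> U"
  using convex_nhds_base_unfolded[OF assms] unfolding convex_def by meson

instance real_normed_vector \<subseteq> locally_convex_space
proof
  fix a :: real and x :: "'a"
  show "LIM p (nhds a \<times>\<^sub>F nhds x). fst p *\<^sub>R snd p :> nhds (a *\<^sub>R x)"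
    by (intro tendsto_scaleR filterlim_fst filterlim_snd)
next
  fix U :: "'a set"
  assume "open U" "0 \<in> U"
  then obtain e where "e > 0" "ball 0 e \<subseteq> U"
    using open_contains_ball by blast
  then show "\<exists>V. open V \<and> 0 \<in> V \<and> V \<subseteq> U \<and>
      (\<forall>x\<in>V. \<forall>y\<in>V. \<forall>u\<ge>0. \<forall>v\<ge>0. u + v = 1 \<longrightarrow> u *\<^sub>R x + v *\<^sub>R y \<in> V)"
    by (intro exI[of _ "ball 0 e"]) (use convex_ball[of "0::'a" e] in \<open>simp add: convex_def\<close>)
qed

text \<open>Product arities for the topological additive classes, which the library only provides
  for normed spaces; they make \<open>Y \<times> \<real>\<close> a locally convex space for the product topology.\<close>

instance prod :: (topological_monoid_add, topological_monoid_add) topological_monoid_add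
proof
  fix c d :: "'a \<times> 'b"
  show "LIM p (nhds c \<times>\<^sub>F nhds d). fst p + snd p :> nhds (c + d)"
    unfolding plus_prod_def
    by (intro tendsto_Pair tendsto_add tendsto_fst tendsto_snd filterlim_fst filterlim_snd)
qed

instance prod :: (topological_comm_monoid_add, topological_comm_monoid_add)
  topological_comm_monoid_add ..

instance prod :: (topological_group_add, topological_group_add) topological_group_add
proof
  fix c :: "'a \<times> 'b"
  show "(uminus \<longlongrightarrow> - c) (nhds c)"
    unfolding uminus_prod_def
    by (intro tendsto_Pair tendsto_minus tendsto_fst tendsto_snd filterlim_ident)
qed

instance prod :: (topological_ab_group_add, topological_ab_group_add)
  topological_ab_group_add ..

instance prod :: (locally_convex_space, locally_convex_space) locally_convex_space
proof
  fix a :: real and c :: "'a \<times> 'b"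
  have 1: "((\<lambda>p. fst p *\<^sub>R fst (snd p)) \<longlongrightarrow> a *\<^sub>R fst c) (nhds a \<times>\<^sub>F nhds c)"
    by (rule filterlim_compose[OF tendsto_scaleR_nhds[of a "fst c"],
          of "\<lambda>p. (fst p, fst (snd p))", unfolded fst_conv snd_conv])
       (intro filterlim_Pair tendsto_fst filterlim_fst filterlim_snd)
  have 2: "((\<lambda>p. fst p *\<^sub>R snd (snd p)) \<longlongrightarrow> a *\<^sub>R snd c) (nhds a \<times>\<^sub>F nhds c)"
    by (rule filterlim_compose[OF tendsto_scaleR_nhds[of a "snd c"],
          of "\<lambda>p. (fst p, snd (snd p))", unfolded fst_conv snd_conv])
       (intro filterlim_Pair tendsto_snd filterlim_fst filterlim_snd)
  show "LIM p (nhds a \<times>\<^sub>F nhds c). fst p *\<^sub>R snd p :> nhds (a *\<^sub>R c)"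
    unfolding scaleR_prod_def by (intro tendsto_Pair 1 2)
next
  fix U :: "('a \<times> 'b) set"
  assume "open U" "0 \<in> U"
  then obtain A B where AB: "open A" "open B" "0 \<in> A" "0 \<in> B" "A \<times> B \<subseteq> U"
    by (metis open_prod_elim mem_Times_iff fst_zero snd_zero)
  obtain V where V: "open V" "convex V" "0 \<in> V" "V \<subseteq> A"
    using convex_nhds_base AB by blast
  obtain W where W: "open W" "convex W" "0 \<in> W" "W \<subseteq> B"
    using convex_nhds_base AB by blast
  have "open (V \<times> W)" "convex (V \<times> W)" "0 \<in> V \<times> W" "V \<times> W \<subseteq> U"
    using AB V W by (auto simp: open_Times convex_Times zero_prod_def)
  then show "\<exists>V. open V \<and> 0 \<in> V \<and> V \<subseteq> U \<and>
      (\<forall>x\<in>V. \<forall>y\<in>V. \<forall>u\<ge>0. \<forall>v\<ge>0. u + v = 1 \<longrightarrow> u *\<^sub>R x + v *\<^sub>R y \<in> V)"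
    unfolding convex_def by (intro exI[of _ "V \<times> W"] conjI)
qed

definition topological_dual :: "('a::{real_vector,topological_space} \<Rightarrow> real) set" where
  "topological_dual = {f. linear f \<and> continuous_on UNIV f}"

definition generated_cone :: "'a::real_vector set \<Rightarrow> 'a set" where
  "generated_cone U = (\<Union>t\<in>{0..}. (*\<^sub>R) t ` U)"

definition quasi_interior :: "'a::{real_vector,topological_space} set \<Rightarrow> 'a set" where
  "quasi_interior U = {u \<in> U. closure (generated_cone ((\<lambda>x. x - u) ` U)) = UNIV}"

definition quasi_relative_interior :: "'a::{real_vector,topological_space} set \<Rightarrow> 'a set" where
  "quasi_relative_interior U =
     {u \<in> U. subspace (closure (generated_cone ((\<lambda>x. x - u) ` U)))}"

text \<open>The binary minus on sets is set-theoretic difference, hence a separate notion for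
  the algebraic one.\<close>

definition algebraic_diff :: "'a::ab_group_add set \<Rightarrow> 'a set \<Rightarrow> 'a set" where
  "algebraic_diff A B = {a - b |a b. a \<in> A \<and> b \<in> B}"

definition effective_domain :: "('a \<Rightarrow> ereal) \<Rightarrow> 'a set" where
  "effective_domain f = {z. f z < \<infinity>}"

definition ereal_epigraph :: "('a \<Rightarrow> ereal) \<Rightarrow> ('a \<times> real) set" where
  "ereal_epigraph f = {(z, r). f z \<le> ereal r}"

definition proper_function :: "('a \<Rightarrow> ereal) \<Rightarrow> bool" where
  "proper_function f \<longleftrightarrow> effective_domain f \<noteq> {} \<and> (\<forall>z. f z > -\<infinity>)"

definition proj_dom :: "('x \<times> 'y \<Rightarrow> ereal) \<Rightarrow> 'y set" where
  "proj_dom \<Phi> = snd ` effective_domain \<Phi>"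

definition proj_epi :: "('x \<times> 'y \<Rightarrow> ereal) \<Rightarrow> ('y \<times> real) set" where
  "proj_epi \<Phi> = (\<lambda>((x, y), r). (y, r)) ` ereal_epigraph \<Phi>"

definition primal_value :: "('x \<times> 'y::zero \<Rightarrow> ereal) \<Rightarrow> ereal" where
  "primal_value \<Phi> = (INF x. \<Phi> (x, 0))"

text \<open>The pairing terms are finite, so the extended-real subtraction below never meets
  \<open>\<infinity> - \<infinity>\<close>.\<close>

definition conjugate ::
  "('x \<times> 'y \<Rightarrow> ereal) \<Rightarrow> ('x \<Rightarrow> real) \<Rightarrow> ('y \<Rightarrow> real) \<Rightarrow> ereal" where
  "conjugate \<Phi> x' y' = (SUP (x, y). ereal (x' x + y' y) - \<Phi> (x, y))"

definition dual_objective :: "('x \<times> 'y \<Rightarrow> ereal) \<Rightarrow> ('y \<Rightarrow> real) \<Rightarrow> ereal" where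
  "dual_objective \<Phi> y' = - conjugate \<Phi> (\<lambda>_. 0) y'"

definition dual_value :: "('x \<times> 'y::{real_vector,topological_space} \<Rightarrow> ereal) \<Rightarrow> ereal" where
  "dual_value \<Phi> = (SUP y'\<in>topological_dual. dual_objective \<Phi> y')"

definition dual_optimal ::
  "('x \<times> 'y::{real_vector,topological_space} \<Rightarrow> ereal) \<Rightarrow> ('y \<Rightarrow> real) \<Rightarrow> bool" where
  "dual_optimal \<Phi> y' \<longleftrightarrow> y' \<in> topological_dual \<and> dual_objective \<Phi> y' = dual_value \<Phi>"

definition shifted_proj_epi :: "('x \<times> 'y::zero \<Rightarrow> ereal) \<Rightarrow> ('y \<times> real) set" where
  "shifted_proj_epi \<Phi> = proj_epi (\<lambda>z. \<Phi> z - primal_value \<Phi>)"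

definition RC6 :: "('x \<times> 'y::{real_vector,topological_space} \<Rightarrow> ereal) \<Rightarrow> bool" where
  "RC6 \<Phi> \<longleftrightarrow>
     0 \<in> quasi_interior (proj_dom \<Phi>) \<and>
     (0, 0) \<notin> quasi_relative_interior (convex hull (shifted_proj_epi \<Phi> \<union> {(0, 0)}))"

definition RC7 :: "('x \<times> 'y::{real_vector,topological_space} \<Rightarrow> ereal) \<Rightarrow> bool" where
  "RC7 \<Phi> \<longleftrightarrow>
     0 \<in> quasi_interior (algebraic_diff (proj_dom \<Phi>) (proj_dom \<Phi>)) \<and>
     0 \<in> quasi_relative_interior (proj_dom \<Phi>) \<and>
     (0, 0) \<notin> quasi_relative_interior (convex hull (shifted_proj_epi \<Phi> \<union> {(0, 0)}))"

end

theory Submission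
  imports Defs
begin

text \<open>The whole argument takes place in \<open>Y \<times> \<real>\<close>. The quasi-relative interior of a convex set is
  exactly the set of its points that cannot be properly supported: \<open>u \<in> C\<close> lies outside \<open>qri C\<close>
  iff some continuous linear functional attains its minimum over \<open>C\<close> at \<open>u\<close> without being
  constant on \<open>C\<close> (lemmas \<open>not_in_qri_imp_proper_support\<close> and \<open>qri_support_imp_constant\<close>).

  Write \<open>v\<close> for the primal value. As \<open>(0, 0)\<close> is outside the quasi-relative interior of
  \<open>co (E \<union> {(0, 0)})\<close>, there is \<open>f (y, r) = g y + c r\<close> which is nonnegative, but not identically
  zero, on \<open>E\<close>. The set \<open>E\<close> is upward closed in \<open>r\<close>, so \<open>c \<ge> 0\<close>. If \<open>c\<close> vanished, \<open>g\<close> would be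
  a nonconstant functional supporting the projected domain at \<open>0\<close>; but in either regularity
  condition \<open>0\<close> is in the quasi-relative interior of that domain, which rules such a \<open>g\<close> out.
  Hence \<open>c > 0\<close>, the hyperplane is not vertical, and \<open>f \<ge> 0\<close> on \<open>E\<close> says that \<open>v - g / c\<close> is a
  continuous affine minorant of \<open>y \<mapsto> inf\<^sub>x \<Phi> (x, y)\<close>, with value \<open>v\<close> at \<open>0\<close>. Its linear part
  \<open>-g / c\<close> is then dual feasible with objective value at least \<open>v\<close>, and weak duality makes it
  optimal.

  The support functional comes from a Hahn--Banach separation of a convex cone \<open>K\<close> from a
  nonempty open convex set \<open>W\<close>. It is proved with cones instead of sublinear functionals: a maximal
  convex cone containing \<open>K\<close> and missing \<open>W\<close> is closed and contains \<open>x\<close> or \<open>-x\<close> for every \<open>x\<close>, so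
  it is a closed half-space, and the functional can be read off from it.\<close>

section \<open>Convex cones in locally convex spaces\<close>

lemma tendsto_scaleR_lcs:
  fixes g :: "'b \<Rightarrow> 'a::locally_convex_space"
  assumes "(f \<longlongrightarrow> a) F" "(g \<longlongrightarrow> x) F"
  shows "((\<lambda>z. f z *\<^sub>R g z) \<longlongrightarrow> a *\<^sub>R x) F"
  using filterlim_compose[OF tendsto_scaleR_nhds filterlim_Pair[OF assms]] by simp

lemma continuous_on_scaleR_lcs:
  fixes g :: "'b::topological_space \<Rightarrow> 'a::locally_convex_space"
  assumes "continuous_on S f" "continuous_on S g"
  shows "continuous_on S (\<lambda>z. f z *\<^sub>R g z)"
  using assms unfolding continuous_on_def by (auto intro: tendsto_scaleR_lcs)

lemma convex_cone_closure_lcs: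
  fixes K :: "'a::locally_convex_space set"
  assumes "convex_cone K"
  shows "convex_cone (closure K)"
  unfolding convex_cone_iff
proof (intro conjI ballI allI impI)
  show "0 \<in> closure K"
    using convex_cone_contains_0[OF assms] closure_subset by blast
next
  fix x y assume xy: "x \<in> closure K" "y \<in> closure K"
  have "(\<lambda>p. fst p + snd p) ` closure (K \<times> K) \<subseteq> closure K"
  proof (rule image_closure_subset)
    show "continuous_on (closure (K \<times> K)) (\<lambda>p. fst p + snd p)"
      by (intro continuous_intros)
    show "(\<lambda>p. fst p + snd p) ` (K \<times> K) \<subseteq> closure K"
      using convex_cone_add[OF assms] closure_subset by fastforce
  qed simp
  then show "x + y \<in> closure K"
    using xy by (force simp: closure_Times)
next
  fix x and c :: real assume x: "x \<in> closure K" and c: "0 \<le> c"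
  have "(*\<^sub>R) c ` closure K \<subseteq> closure K"
  proof (rule image_closure_subset)
    show "continuous_on (closure K) ((*\<^sub>R) c)"
      by (intro continuous_on_scaleR_lcs continuous_intros)
    show "(*\<^sub>R) c ` K \<subseteq> closure K"
      using convex_cone_scaleR[OF assms c] closure_subset by fastforce
  qed simp
  then show "c *\<^sub>R x \<in> closure K"
    using x by blast
qed

lemma convex_cone_add_ray:
  assumes "convex_cone M"
  shows "convex_cone {m + t *\<^sub>R x |m t. m \<in> M \<and> 0 \<le> t}" (is "convex_cone ?R")
  unfolding convex_cone_iff
proof (intro conjI ballI allI impI)
  show "0 \<in> ?R"
    using convex_cone_contains_0[OF assms] by force
next
  fix a b assume "a \<in> ?R" "b \<in> ?R"
  then obtain m s n t where "a = m + s *\<^sub>R x" "b = n + t *\<^sub>R x" "m \<in> M" "n \<in> M" "0 \<le> s" "0 \<le> t"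
    by blast
  then have "a + b = (m + n) + (s + t) *\<^sub>R x" "m + n \<in> M" "0 \<le> s + t"
    using convex_cone_add[OF assms] by (auto simp: algebra_simps)
  then show "a + b \<in> ?R"
    by blast
next
  fix a and c :: real assume "a \<in> ?R" "0 \<le> c"
  then obtain m s where "a = m + s *\<^sub>R x" "m \<in> M" "0 \<le> s"
    by blast
  then have "c *\<^sub>R a = c *\<^sub>R m + (c * s) *\<^sub>R x" "c *\<^sub>R m \<in> M" "0 \<le> c * s"
    using convex_cone_scaleR[OF assms] \<open>0 \<le> c\<close> by (auto simp: algebra_simps)
  then show "c *\<^sub>R a \<in> ?R"
    by blast
qed

section \<open>Separation of a cone from an open convex set\<close>

text \<open>Maximality gives both properties of \<open>M\<close>. The closure of \<open>M\<close> is a competitor because an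
  open set that misses \<open>M\<close> misses its closure. If neither \<open>x\<close> nor \<open>-x\<close> were in \<open>M\<close>, adjoining
  either ray would make the cone hit \<open>W\<close>, and the segment between the two points of \<open>W\<close> so obtained
  contains a point where the \<open>x\<close>-components cancel, hence a point of \<open>M\<close>.\<close>

lemma maximal_convex_cone_avoiding_open:
  fixes K W :: "'a::locally_convex_space set"
  assumes K: "convex_cone K" and W: "open W" "convex W" and disj: "K \<inter> W = {}"
  obtains M where "convex_cone M" "closed M" "K \<subseteq> M" "M \<inter> W = {}" "\<And>x. x \<in> M \<or> - x \<in> M"
proof -
  define \<A> where "\<A> = {M. convex_cone M \<and> K \<subseteq> M \<and> M \<inter> W = {}}"
  have "\<exists>M\<in>\<A>. \<forall>X\<in>\<A>. M \<subseteq> X \<longrightarrow> X = M"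
  proof (rule subset_Zorn_nonempty)
    show "\<A> \<noteq> {}"
      using K disj by (auto simp: \<A>_def)
  next
    fix \<C> assume ne: "\<C> \<noteq> {}" and ch: "subset.chain \<A> \<C>"
    have mem: "convex_cone X" "K \<subseteq> X" "X \<inter> W = {}" if "X \<in> \<C>" for X
      using ch that by (auto simp: \<A>_def subset_chain_def)
    have "convex_cone (\<Union>\<C>)"
      unfolding convex_cone_iff
    proof (intro conjI ballI allI impI)
      show "0 \<in> \<Union>\<C>"
        using ne mem(1) convex_cone_contains_0 by blast
    next
      fix x y assume "x \<in> \<Union>\<C>" "y \<in> \<Union>\<C>"
      then obtain X Y where XY: "X \<in> \<C>" "Y \<in> \<C>" "x \<in> X" "y \<in> Y"
        by blast
      then have "X \<subseteq> Y \<or> Y \<subseteq> X"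
        using ch by (auto simp: subset_chain_def)
      then show "x + y \<in> \<Union>\<C>"
        using XY convex_cone_add[OF mem(1)] by blast
    next
      fix x and c :: real assume "x \<in> \<Union>\<C>" "0 \<le> c"
      then show "c *\<^sub>R x \<in> \<Union>\<C>"
        using convex_cone_scaleR[OF mem(1)] by blast
    qed
    moreover have "K \<subseteq> \<Union>\<C>"
      using ne mem(2) by blast
    moreover have "\<Union>\<C> \<inter> W = {}"
      using mem(3) by blast
    ultimately show "\<Union>\<C> \<in> \<A>"
      by (simp add: \<A>_def)
  qed
  then obtain M where "M \<in> \<A>" and max: "\<And>X. X \<in> \<A> \<Longrightarrow> M \<subseteq> X \<Longrightarrow> X = M"
    by blast
  then have M: "convex_cone M" "K \<subseteq> M" "M \<inter> W = {}"
    by (auto simp: \<A>_def)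
  have "closure M \<in> \<A>"
    using M W(1) closure_subset[of M] convex_cone_closure_lcs[OF M(1)]
    by (auto simp: \<A>_def open_Int_closure_eq_empty Int_commute)
  then have cl: "closed M"
    using max closure_subset by (metis closed_closure)
  have hit: "\<exists>m\<in>M. \<exists>t>0. m + t *\<^sub>R x \<in> W" if x: "x \<notin> M" for x
  proof (rule ccontr)
    assume no: "\<not> ?thesis"
    define R where "R = {m + t *\<^sub>R x |m t. m \<in> M \<and> 0 \<le> t}"
    have MR: "M \<subseteq> R"
    proof
      fix m assume "m \<in> M"
      then have "m + 0 *\<^sub>R x \<in> R"
        unfolding R_def by blast
      then show "m \<in> R"
        by simp
    qed
    have "R \<inter> W = {}"
    proof (rule ccontr)
      assume "R \<inter> W \<noteq> {}"
      then obtain m t where mt: "m \<in> M" "0 \<le> t" "m + t *\<^sub>R x \<in> W"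
        by (auto simp: R_def)
      then have "t \<noteq> 0"
        using M(3) by auto
      then show False
        using mt no by (metis order_le_less)
    qed
    then have "R \<in> \<A>"
      using M MR convex_cone_add_ray[OF M(1), of x] by (auto simp: \<A>_def R_def)
    then have "R = M"
      using max MR by blast
    moreover have "0 + 1 *\<^sub>R x \<in> R"
      unfolding R_def using convex_cone_contains_0[OF M(1)] zero_le_one by blast
    ultimately show False
      using x by simp
  qed
  have "x \<in> M \<or> - x \<in> M" for x
  proof (rule ccontr)
    assume "\<not> ?thesis"
    then obtain m s n t where mn: "m \<in> M" "n \<in> M" "s > 0" "t > 0"
      and mW: "m + s *\<^sub>R x \<in> W" and nW: "n + t *\<^sub>R (- x) \<in> W"
      using hit[of x] hit[of "- x"] by blast
    define a b where "a = t / (s + t)" and "b = s / (s + t)"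
    have ab: "0 \<le> a" "0 \<le> b" "a + b = 1" "a * s = b * t"
      using mn by (auto simp: a_def b_def simp flip: add_divide_distrib)
    have "a *\<^sub>R (m + s *\<^sub>R x) + b *\<^sub>R (n + t *\<^sub>R (- x)) \<in> W"
      using W(2) mW nW ab by (simp add: convex_def)
    also have "a *\<^sub>R (m + s *\<^sub>R x) + b *\<^sub>R (n + t *\<^sub>R (- x)) = a *\<^sub>R m + b *\<^sub>R n"
      using ab(4) by (simp add: algebra_simps)
    finally have "a *\<^sub>R m + b *\<^sub>R n \<in> W" .
    moreover have "a *\<^sub>R m + b *\<^sub>R n \<in> M"
      using mn ab by (intro convex_cone_add[OF M(1)] convex_cone_scaleR[OF M(1)])
    ultimately show False
      using M(3) by blast
  qed
  with M cl show ?thesis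
    using that by blast
qed

text \<open>Near a point of \<open>W\<close>, in both directions \<open>x\<close> and \<open>-x\<close>, the bound on \<open>W\<close> becomes a two-sided
  bound on a neighbourhood of \<open>0\<close>, which scaling makes arbitrarily small. It is the negativity of the separating functional on \<open>W\<close>
  that provides its continuity in this way.\<close>

lemma linear_bounded_above_on_open_imp_continuous:
  fixes f :: "'a::locally_convex_space \<Rightarrow> real"
  assumes f: "linear f" and W: "open W" "w \<in> W" and bound: "\<And>x. x \<in> W \<Longrightarrow> f x \<le> c"
  shows "continuous_on UNIV f"
proof -
  interpret f: linear f by (rule f)
  define d where "d = c - f w"
  have d: "d \<ge> 0"
    using bound[OF W(2)] by (simp add: d_def)
  define N where "N = (\<lambda>x. w + x) -` W \<inter> (\<lambda>x. w - x) -` W"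
  have N: "open N" "0 \<in> N"
    unfolding N_def using W
    by (auto intro!: open_Int open_vimage continuous_intros)
  have fN: "\<bar>f x\<bar> \<le> d" if "x \<in> N" for x
    using bound[of "w + x"] bound[of "w - x"] that
    by (auto simp: N_def d_def f.add f.diff)
  have "(f \<longlongrightarrow> f z) (at z)" for z
  proof (rule tendstoI)
    fix e :: real assume e: "e > 0"
    define k where "k = (d + 1) / e"
    have k: "k > 0"
      using e d by (simp add: k_def)
    have "open ((\<lambda>x. k *\<^sub>R (x - z)) -` N)"
      by (intro open_vimage N continuous_on_scaleR_lcs continuous_intros)
    then have "\<forall>\<^sub>F x in at z. x \<in> (\<lambda>x. k *\<^sub>R (x - z)) -` N"
      using N(2) by (intro eventually_at_in_open') auto
    then show "\<forall>\<^sub>F x in at z. dist (f x) (f z) < e"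
    proof eventually_elim
      case (elim x)
      have "k * \<bar>f x - f z\<bar> \<le> d"
        using fN[of "k *\<^sub>R (x - z)"] elim k
        by (simp add: f.scaleR f.diff abs_mult)
      then have "\<bar>f x - f z\<bar> \<le> d / k"
        using k by (simp add: field_simps)
      also have "d / k < e"
        using d e by (simp add: k_def field_simps)
      finally show ?case
        by (simp add: dist_real_def)
    qed
  qed
  then show ?thesis
    by (simp add: continuous_on_def)
qed

text \<open>The maximal cone \<open>M\<close> behaves like a half-space with lineality space \<open>L = M \<inter> -M\<close>, and \<open>-w\<close>
  points to its inside for \<open>w \<in> W\<close>. The value \<open>f x\<close> is the coefficient of \<open>x\<close> along \<open>e = -w\<close> modulo
  \<open>L\<close>. It exists because each line in direction \<open>e\<close> is covered by the closed sets \<open>M\<close> and \<open>-M\<close> and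
  meets both, so by connectedness of the line it meets \<open>L\<close>.\<close>

theorem convex_cone_separation_open:
  fixes K W :: "'a::locally_convex_space set"
  assumes K: "convex_cone K" and W: "open W" "convex W" "W \<noteq> {}" and disj: "K \<inter> W = {}"
  obtains f where "f \<in> topological_dual" "\<And>x. x \<in> K \<Longrightarrow> 0 \<le> f x" "\<And>x. x \<in> W \<Longrightarrow> f x < 0"
proof -
  obtain M where M: "convex_cone M" and clM: "closed M" and KM: "K \<subseteq> M" and MW: "M \<inter> W = {}"
    and total: "\<And>x. x \<in> M \<or> - x \<in> M"
    using maximal_convex_cone_avoiding_open[OF K W(1,2) disj] by blast
  note M_add = convex_cone_add[OF M] and M_scale = convex_cone_scaleR[OF M]
  obtain w where w: "w \<in> W"
    using W(3) by blast
  define e where "e = - w"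
  have neg_W: "- x \<in> M" if "x \<in> W" for x
    using total[of x] that MW by blast
  have e: "e \<in> M" "- e \<notin> M"
    using neg_W[OF w] w MW by (auto simp: e_def)
  define L where "L = {x. x \<in> M \<and> - x \<in> M}"
  have L: "subspace L"
    unfolding subspace_def
  proof (intro conjI ballI allI)
    show "0 \<in> L"
      using convex_cone_contains_0[OF M] by (simp add: L_def)
  next
    fix x y assume "x \<in> L" "y \<in> L"
    then show "x + y \<in> L"
      using M_add[of x y] M_add[of "- x" "- y"] by (simp add: L_def)
  next
    fix c x assume x: "x \<in> L"
    show "c *\<^sub>R x \<in> L"
    proof (cases "c \<ge> 0")
      case True
      then show ?thesis
        using x M_scale[of c x] M_scale[of c "- x"] by (simp add: L_def)
    next
      case False
      then show ?thesis
        using x M_scale[of "- c" x] M_scale[of "- c" "- x"] by (simp add: L_def)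
    qed
  qed
  have absorb: "\<exists>t. t *\<^sub>R e - x \<in> M" for x
  proof -
    have "open ((\<lambda>s::real. w + s *\<^sub>R x) -` W)"
      by (intro open_vimage W continuous_on_scaleR_lcs continuous_intros)
    then obtain r where r: "r > 0" "ball 0 r \<subseteq> (\<lambda>s::real. w + s *\<^sub>R x) -` W"
      using w openE[of "(\<lambda>s::real. w + s *\<^sub>R x) -` W" 0] by auto
    have "w + (r / 2) *\<^sub>R x \<in> W"
      using r by (auto simp: dist_real_def subset_iff)
    then have "- (w + (r / 2) *\<^sub>R x) \<in> M"
      by (rule neg_W)
    then have "(2 / r) *\<^sub>R (- (w + (r / 2) *\<^sub>R x)) \<in> M"
      using r by (intro M_scale) auto
    then have "(2 / r) *\<^sub>R e - x \<in> M"
      using r by (simp add: e_def algebra_simps)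
    then show ?thesis ..
  qed
  have coeff_ex: "\<exists>t. x - t *\<^sub>R e \<in> L" for x
  proof -
    define S T where "S = (\<lambda>t::real. t *\<^sub>R e - x) -` M" and "T = (\<lambda>t::real. x - t *\<^sub>R e) -` M"
    have "closed S" "closed T"
      unfolding S_def T_def
      by (intro closed_vimage clM continuous_on_scaleR_lcs continuous_intros)+
    moreover have "S \<noteq> {}"
      using absorb[of x] by (auto simp: S_def)
    moreover obtain t where "t *\<^sub>R e + x \<in> M"
      using absorb[of "- x"] by auto
    then have "- t \<in> T"
      by (simp add: T_def add.commute)
    then have "T \<noteq> {}"
      by blast
    moreover have "S \<union> T = UNIV"
      using total by (force simp: S_def T_def)
    ultimately have "S \<inter> T \<noteq> {}"
      using connected_UNIV[where 'a = real] unfolding connected_closed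
      by (metis Int_UNIV_right order_refl)
    then show ?thesis
      by (auto simp: S_def T_def L_def)
  qed
  have coeff_unique: "s = t" if s: "x - s *\<^sub>R e \<in> L" and t: "x - t *\<^sub>R e \<in> L" for x s t
  proof (rule ccontr)
    assume ne: "s \<noteq> t"
    have "(x - s *\<^sub>R e) - (x - t *\<^sub>R e) \<in> L"
      using subspace_diff[OF L s t] .
    then have "(t - s) *\<^sub>R e \<in> L"
      by (simp add: algebra_simps)
    then have "(1 / (t - s)) *\<^sub>R (t - s) *\<^sub>R e \<in> L"
      by (rule subspace_scale[OF L])
    then have "e \<in> L"
      using ne by simp
    then show False
      using e by (simp add: L_def)
  qed
  define f where "f x = (THE t. x - t *\<^sub>R e \<in> L)" for x
  have f_eq: "f x = t" if "x - t *\<^sub>R e \<in> L" for x t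
    unfolding f_def using that coeff_unique by blast
  have f_L: "x - f x *\<^sub>R e \<in> L" for x
    using coeff_ex f_eq by metis
  have lin: "linear f"
  proof (rule linearI)
    fix x y
    have "(x - f x *\<^sub>R e) + (y - f y *\<^sub>R e) \<in> L"
      using subspace_add[OF L f_L f_L] .
    then show "f (x + y) = f x + f y"
      by (intro f_eq) (simp add: algebra_simps)
  next
    fix c x
    have "c *\<^sub>R (x - f x *\<^sub>R e) \<in> L"
      using subspace_scale[OF L f_L] .
    then show "f (c *\<^sub>R x) = c *\<^sub>R f x"
      by (intro f_eq) (simp add: algebra_simps)
  qed
  have nonneg: "0 \<le> f x" if x: "x \<in> M" for x
  proof (rule ccontr)
    assume neg: "\<not> 0 \<le> f x"
    have "- (x - f x *\<^sub>R e) + x \<in> M"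
      using f_L[of x] x by (intro M_add) (simp_all add: L_def)
    then have fx: "f x *\<^sub>R e \<in> M"
      by simp
    have "inverse (- f x) *\<^sub>R f x *\<^sub>R e \<in> M"
      using neg by (intro M_scale fx) simp
    then show False
      using e(2) neg by simp
  qed
  have neg: "f x < 0" if x: "x \<in> W" for x
  proof (rule ccontr)
    assume "\<not> f x < 0"
    then have "(x - f x *\<^sub>R e) + f x *\<^sub>R e \<in> M"
      using f_L[of x] M_scale[OF _ e(1)] M_add by (simp only: L_def mem_Collect_eq not_less)
    then show False
      using x MW by auto
  qed
  have "f \<in> topological_dual"
    unfolding topological_dual_def
    using lin linear_bounded_above_on_open_imp_continuous[OF lin W(1) w, of 0] neg
    by (auto intro: less_imp_le)
  with nonneg neg KM show ?thesis
    using that by blast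
qed

corollary closed_convex_cone_separation_point:
  fixes K :: "'a::locally_convex_space set"
  assumes K: "convex_cone K" "closed K" and q: "q \<notin> K"
  obtains f where "f \<in> topological_dual" "\<And>x. x \<in> K \<Longrightarrow> 0 \<le> f x" "f q < 0"
proof -
  have "open ((\<lambda>x. q + x) -` (- K))"
    using K(2) by (intro open_vimage continuous_intros) auto
  then obtain V where V: "open V" "convex V" "0 \<in> V" "V \<subseteq> (\<lambda>x. q + x) -` (- K)"
    using q convex_nhds_base[of "(\<lambda>x. q + x) -` (- K)"] by auto
  define W where "W = (\<lambda>x. q + x) ` V"
  have "W = (\<lambda>x. x - q) -` V"
    by (force simp: W_def)
  moreover have "open ((\<lambda>x. x - q) -` V)"
    using V(1) by (intro open_vimage continuous_intros)
  ultimately have "open W"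
    by simp
  moreover have "convex W" "q \<in> W" "K \<inter> W = {}"
    using V by (auto simp: W_def convex_translation)
  ultimately show ?thesis
    using convex_cone_separation_open[OF K(1), of W] that by blast
qed

section \<open>Quasi-relative interior and supporting functionals\<close>

lemma quasi_interior_subset_quasi_relative_interior:
  "quasi_interior U \<subseteq> quasi_relative_interior U"
  by (auto simp: quasi_interior_def quasi_relative_interior_def)

lemma convex_cone_generated_cone:
  assumes "convex U" "U \<noteq> {}"
  shows "convex_cone (generated_cone U)"
proof -
  have "generated_cone U = conic hull U"
    by (auto simp: generated_cone_def conic_hull_explicit)
  then show ?thesis
    using assms by (simp add: convex_cone_def convex_conic_hull conic_conic_hull conic_hull_eq_empty)
qed

lemma subset_generated_cone: "U \<subseteq> generated_cone U"
  unfolding generated_cone_def by (force intro: bexI[of _ 1])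

lemma dual_nonneg_on_closure_generated_cone:
  assumes f: "f \<in> topological_dual" and nonneg: "\<And>x. x \<in> U \<Longrightarrow> 0 \<le> f x"
    and x: "x \<in> closure (generated_cone U)"
  shows "0 \<le> f x"
proof -
  have "f ` closure (generated_cone U) \<subseteq> {0..}"
  proof (rule image_closure_subset)
    show "continuous_on (closure (generated_cone U)) f"
      using f continuous_on_subset by (auto simp: topological_dual_def)
    show "f ` generated_cone U \<subseteq> {0..}"
      using f nonneg by (auto simp: generated_cone_def topological_dual_def linear_scale)
  qed simp
  then show ?thesis
    using x by auto
qed

text \<open>A continuous functional that is nonnegative on a linear subspace vanishes there, since it is
  nonnegative at \<open>x\<close> and \<open>-x\<close>.\<close>

lemma qri_support_imp_constant:
  assumes u: "u \<in> quasi_relative_interior C" and f: "f \<in> topological_dual"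
    and supp: "\<And>x. x \<in> C \<Longrightarrow> f u \<le> f x" and x: "x \<in> C"
  shows "f x = f u"
proof -
  define D where "D = (\<lambda>x. x - u) ` C"
  have lin: "linear f"
    using f by (simp add: topological_dual_def)
  have sub: "subspace (closure (generated_cone D))"
    using u by (simp add: quasi_relative_interior_def D_def)
  have nonneg: "0 \<le> f z" if "z \<in> closure (generated_cone D)" for z
    using supp lin by (intro dual_nonneg_on_closure_generated_cone[OF f _ that])
      (auto simp: D_def linear_diff)
  have mem: "x - u \<in> closure (generated_cone D)"
    using x subset_generated_cone[of D] closure_subset by (fastforce simp: D_def)
  have "0 \<le> f (- (x - u))"
    using nonneg subspace_neg[OF sub mem] .
  then show ?thesis
    using supp[OF x] lin by (simp add: linear_diff)
qed

text \<open>If the closed convex cone \<open>K\<close> generated by \<open>C - u\<close> is not a subspace, it contains some \<open>p\<close> with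
  \<open>-p \<notin> K\<close>. Separating \<open>-p\<close> from \<open>K\<close> gives a functional that is nonnegative on \<open>K\<close> and positive
  at \<open>p\<close>; were it constant on \<open>C\<close>, it would vanish on all of \<open>K\<close>.\<close>

lemma not_in_qri_imp_proper_support:
  fixes C :: "'a::locally_convex_space set"
  assumes C: "convex C" and u: "u \<in> C" "u \<notin> quasi_relative_interior C"
  obtains f where "f \<in> topological_dual" "\<And>x. x \<in> C \<Longrightarrow> f u \<le> f x" "\<exists>x\<in>C. f u < f x"
proof -
  define D where "D = (\<lambda>x. x - u) ` C"
  define K where "K = closure (generated_cone D)"
  have D: "convex D" "D \<noteq> {}"
    using C u(1) by (auto simp: D_def convex_translation_subtract)
  have K: "convex_cone K"
    unfolding K_def by (intro convex_cone_closure_lcs convex_cone_generated_cone D)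
  have DK: "D \<subseteq> K"
    unfolding K_def using subset_generated_cone[of D] closure_subset by blast
  have "\<exists>p\<in>K. - p \<notin> K"
  proof (rule ccontr)
    assume sym: "\<not> ?thesis"
    have "c *\<^sub>R x \<in> K" if "x \<in> K" for c x
      using convex_cone_scaleR[OF K, of c x] convex_cone_scaleR[OF K, of "- c" x] that sym
      by (cases "0 \<le> c") force+
    then have "subspace K"
      using K by (auto simp: subspace_def convex_cone_iff)
    then show False
      using u by (simp add: quasi_relative_interior_def K_def D_def)
  qed
  then obtain p where p: "p \<in> K" "- p \<notin> K"
    by blast
  obtain f where f: "f \<in> topological_dual" and nonneg: "\<And>x. x \<in> K \<Longrightarrow> 0 \<le> f x" and "f (- p) < 0"
    using closed_convex_cone_separation_point[OF K _ p(2)] K_def closed_closure by blast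
  have lin: "linear f"
    using f by (simp add: topological_dual_def)
  have fp: "0 < f p"
    using \<open>f (- p) < 0\<close> lin by (simp add: linear_neg)
  have supp: "f u \<le> f x" if "x \<in> C" for x
    using nonneg[of "x - u"] DK that lin by (auto simp: D_def linear_diff)
  have "\<exists>x\<in>C. f u < f x"
  proof (rule ccontr)
    assume "\<not> ?thesis"
    then have "0 \<le> - f x" if "x \<in> D" for x
      using that lin by (auto simp: D_def linear_diff not_less)
    moreover have "(\<lambda>x. - f x) \<in> topological_dual"
      using f by (auto simp: topological_dual_def linear_compose_neg intro: continuous_intros)
    ultimately have "0 \<le> - f p"
      using dual_nonneg_on_closure_generated_cone[of "\<lambda>x. - f x" D p] p(1) by (simp add: K_def)
    then show False
      using fp by simp
  qed
  with f supp show ?thesis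
    using that by blast
qed

section \<open>Duality\<close>

lemma dual_objective_le_primal_value:
  assumes "y' \<in> topological_dual"
  shows "dual_objective \<Phi> y' \<le> primal_value \<Phi>"
  unfolding primal_value_def
proof (rule INF_greatest)
  fix x
  have "y' 0 = 0"
    using assms by (simp add: topological_dual_def linear_0)
  then have "- \<Phi> (x, 0) \<le> conjugate \<Phi> (\<lambda>_. 0) y'"
    unfolding conjugate_def by (intro SUP_upper2[of "(x, 0)"]) (auto simp: zero_ereal_def[symmetric])
  then show "dual_objective \<Phi> y' \<le> \<Phi> (x, 0)"
    unfolding dual_objective_def by (simp add: ereal_uminus_le_reorder)
qed

lemma dual_optimal_if_ge_primal_value:
  assumes y': "y' \<in> topological_dual" and ge: "primal_value \<Phi> \<le> dual_objective \<Phi> y'"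
  shows "primal_value \<Phi> = dual_value \<Phi>" "dual_optimal \<Phi> y'"
proof -
  have "dual_value \<Phi> \<le> primal_value \<Phi>"
    unfolding dual_value_def by (intro SUP_least dual_objective_le_primal_value)
  moreover have "dual_objective \<Phi> y' \<le> dual_value \<Phi>"
    unfolding dual_value_def using y' by (rule SUP_upper)
  ultimately show "primal_value \<Phi> = dual_value \<Phi>" "dual_optimal \<Phi> y'"
    using y' ge by (auto simp: dual_optimal_def)
qed

lemma le_dual_objectiveI:
  assumes minor: "\<And>x y a. \<Phi> (x, y) = ereal a \<Longrightarrow> v + y' y \<le> a" and proper: "\<And>z. \<Phi> z > - \<infinity>"
  shows "ereal v \<le> dual_objective \<Phi> y'"
proof -
  have "ereal (0 + y' y) - \<Phi> (x, y) \<le> ereal (- v)" for x y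
    using minor[of x y] proper[of "(x, y)"] by (cases "\<Phi> (x, y)") force+
  then have "conjugate \<Phi> (\<lambda>_. 0) y' \<le> ereal (- v)"
    unfolding conjugate_def by (intro SUP_least) auto
  then show ?thesis
    unfolding dual_objective_def by (metis ereal_minus_le_minus ereal_uminus_uminus uminus_ereal.simps(1))
qed

lemma shifted_proj_epi_iff:
  assumes "primal_value \<Phi> = ereal v"
  shows "(y, r) \<in> shifted_proj_epi \<Phi> \<longleftrightarrow> (\<exists>x. \<Phi> (x, y) \<le> ereal (v + r))"
proof -
  have "\<Phi> z - ereal v \<le> ereal r \<longleftrightarrow> \<Phi> z \<le> ereal (v + r)" for z
    by (cases "\<Phi> z") auto
  then show ?thesis
    by (force simp: shifted_proj_epi_def proj_epi_def ereal_epigraph_def assms)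
qed

theorem theorem10:
  fixes \<Phi> :: "'x::locally_convex_space \<times> 'y::locally_convex_space \<Rightarrow> ereal"
  assumes "proper_function \<Phi>"
    and "primal_value \<Phi> \<in> range ereal"
    and "convex (proj_epi \<Phi>)"
    and "RC6 \<Phi> \<or> RC7 \<Phi>"
  shows "primal_value \<Phi> = dual_value \<Phi> \<and> (\<exists>y'. dual_optimal \<Phi> y')"
proof -
  obtain v where v: "primal_value \<Phi> = ereal v"
    using assms(2) by blast
  have proper: "\<Phi> z > - \<infinity>" for z
    using assms(1) unfolding proper_function_def by blast
  define E where "E = shifted_proj_epi \<Phi>"
  define C where "C = convex hull (E \<union> {(0, 0)})"
  have E_iff: "(y, r) \<in> E \<longleftrightarrow> (\<exists>x. \<Phi> (x, y) \<le> ereal (v + r))" for y r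
    unfolding E_def by (rule shifted_proj_epi_iff[OF v])
  have qri_dom: "0 \<in> quasi_relative_interior (proj_dom \<Phi>)"
    using assms(4) quasi_interior_subset_quasi_relative_interior by (auto simp: RC6_def RC7_def)
  have "(0, 0) \<notin> quasi_relative_interior C"
    using assms(4) by (auto simp: RC6_def RC7_def C_def E_def)
  moreover have EC: "E \<subseteq> C" "(0, 0) \<in> C"
    using hull_subset[of "E \<union> {(0, 0)}" convex] by (auto simp: C_def)
  ultimately obtain f where f: "f \<in> topological_dual"
    and supp: "\<And>p. p \<in> C \<Longrightarrow> f (0, 0) \<le> f p" and strict: "\<exists>p\<in>C. f (0, 0) < f p"
    using not_in_qri_imp_proper_support[of C "(0, 0)"] unfolding C_def by (metis convex_convex_hull)
  have lin: "linear f" and cont: "continuous_on UNIV f"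
    using f by (auto simp: topological_dual_def)
  have f0: "f (0, 0) = 0"
    using linear_0[OF lin] by (simp add: zero_prod_def)
  have f_nonneg: "0 \<le> f p" if "p \<in> E" for p
    using supp[of p] EC that f0 by auto
  have "\<exists>p\<in>E. f p \<noteq> 0"
  proof (rule ccontr)
    assume "\<not> ?thesis"
    then have "E \<union> {(0, 0)} \<subseteq> {p. f p = 0}"
      using f0 by auto
    moreover have "convex {p. f p = 0}"
      using lin by (intro subspace_imp_convex) (rule linear_subspace_kernel)
    ultimately have "C \<subseteq> {p. f p = 0}"
      unfolding C_def by (rule hull_minimal)
    then show False
      using strict f0 by auto
  qed
  then obtain y1 r1 where yr1: "(y1, r1) \<in> E" "f (y1, r1) \<noteq> 0"
    by auto
  define g where "g y = f (y, 0)" for y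
  define c where "c = f (0, 1)"
  have f_split: "f (y, r) = g y + c * r" for y r
  proof -
    have "f (y, r) = f ((y, 0) + r *\<^sub>R (0, 1))"
      by simp
    also have "\<dots> = g y + c * r"
      using lin by (simp only: linear_add linear_scale g_def c_def real_scaleR_def mult.commute)
    finally show ?thesis .
  qed
  have g_lin: "linear g"
  proof (rule linearI)
    show "g (x + y) = g x + g y" for x y
      using linear_add[OF lin, of "(x, 0)" "(y, 0)"] by (simp add: g_def)
    show "g (a *\<^sub>R x) = a *\<^sub>R g x" for a x
      using linear_scale[OF lin, of a "(x, 0)"] by (simp add: g_def)
  qed
  have g_dual: "(\<lambda>y. k * g y) \<in> topological_dual" for k
  proof -
    have "continuous_on UNIV (\<lambda>y. k * g y)"
      unfolding g_def
      by (intro continuous_intros continuous_on_compose2[OF cont]) auto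
    then show ?thesis
      using linear_compose_scale_right[OF g_lin, of k] by (simp add: topological_dual_def)
  qed
  have c_nonneg: "0 \<le> c"
  proof (rule ccontr)
    assume neg: "\<not> 0 \<le> c"
    \<comment> \<open>high enough above \<open>(y1, r1)\<close>, where \<open>g y1 + c * r\<close> has become negative\<close>
    define r where "r = max r1 ((g y1 + 1) / - c)"
    have "(y1, r) \<in> E"
    proof -
      obtain x where x: "\<Phi> (x, y1) \<le> ereal (v + r1)"
        using yr1(1) E_iff by blast
      also have "ereal (v + r1) \<le> ereal (v + r)"
        by (simp add: r_def)
      finally show ?thesis
        using E_iff by blast
    qed
    then have "0 \<le> g y1 + c * r"
      using f_nonneg f_split by metis
    moreover have "(g y1 + 1) / - c \<le> r"
      by (simp add: r_def)
    then have "g y1 + 1 \<le> - c * r"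
      using neg by (simp add: field_simps)
    ultimately show False
      by simp
  qed
  have "c \<noteq> 0"
  proof
    assume c0: "c = 0"
    have g_supp: "g 0 \<le> g y" if y: "y \<in> proj_dom \<Phi>" for y
    proof -
      obtain x where "\<Phi> (x, y) < \<infinity>"
        using y by (auto simp: proj_dom_def effective_domain_def)
      then obtain a where "\<Phi> (x, y) = ereal a"
        using proper[of "(x, y)"] by (cases "\<Phi> (x, y)") auto
      then have "(y, a - v) \<in> E"
        unfolding E_iff by (intro exI[of _ x]) simp
      then have "0 \<le> f (y, a - v)"
        by (rule f_nonneg)
      then show ?thesis
        using f_split c0 linear_0[OF g_lin] by simp
    qed
    obtain x where "\<Phi> (x, y1) \<le> ereal (v + r1)"
      using yr1(1) E_iff by blast
    then have "\<Phi> (x, y1) < \<infinity>"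
      by (rule order_le_less_trans) simp
    then have "y1 \<in> proj_dom \<Phi>"
      by (force simp: proj_dom_def effective_domain_def)
    then have "g y1 = g 0"
      using qri_support_imp_constant[OF qri_dom, of g] g_dual[of 1] g_supp by simp
    then show False
      using yr1(2) f_split c0 linear_0[OF g_lin] by simp
  qed
  with c_nonneg have c: "c > 0"
    by simp
  define y' where "y' y = (- 1 / c) * g y" for y
  have y': "y' \<in> topological_dual"
    unfolding y'_def by (rule g_dual)
  have "ereal v \<le> dual_objective \<Phi> y'"
  proof (rule le_dual_objectiveI[OF _ proper])
    fix x y a assume a: "\<Phi> (x, y) = ereal a"
    then have "(y, a - v) \<in> E"
      unfolding E_iff by (intro exI[of _ x]) simp
    then have "0 \<le> g y + c * (a - v)"
      using f_nonneg f_split by metis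
    then show "v + y' y \<le> a"
      using c by (simp add: y'_def field_simps)
  qed
  then show ?thesis
    using dual_optimal_if_ge_primal_value[OF y', of \<Phi>] v by auto
qed

end
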